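(* Fix $t\ge 0$ and let $h(\cdot)$ be any function of $\mathbf{x}_t$ with $h(\mathbf{x}_t)$ square integrable. For integers $\Delta\ge 0$ define $$\mathit{II}(\Delta)=E_{\pi_t}\Big[\,E\big(h(\mathbf{x}_t)\mid \mathbf{y}_{t+\Delta}\big)-h(\mathbf{x}_t)\Big]^2 ,$$ where $E_{\pi_t}[\cdot]=E[\cdot\mid \mathbf{y}_t]$ averages over both the true state $\mathbf{x}_t$ and the future observations $y_{t+1},\dots,y_{t+\Delta}$ conditionally on $\mathbf{y}_t$. Then $\mathit{II}(\Delta)$ decreases (in the weak sense, i.e. is non-increasing) as $\Delta$ increases: $\mathit{II}(\Delta_2)\le \mathit{II}(\Delta_1)$ for all $\Delta_2>\Delta_1\ge 0$.
   Context: A stochastic dynamic system consists of latent states $x_0,x_1,x_2,\dots$ and observations $y_1,y_2,\dots$, all random variables with a joint distribution. Write $\mathbf{x}_t=(x_0,\dots,x_t)$ and $\mathbf{y}_t=(y_1,\dots,y_t)$, so the information available increases with time ($\mathbf{y}_{t+1}=(\mathbf{y}_t,y_{t+1})$). The target distribution at time $t$ is $\pi_t(\mathbf{x}_t)=p(\mathbf{x}_t\mid\mathbf{y}_t)$, the conditional distribution of $\mathbf{x}_t$ given $\mathbf{y}_t$. *)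

theory Defs
  imports "HOL-Probability.Probability"
begin

definition traj :: "nat set \<Rightarrow> (nat \<Rightarrow> 'w \<Rightarrow> 'a) \<Rightarrow> 'w \<Rightarrow> nat \<Rightarrow> 'a" where
  "traj I z \<omega> = (\<lambda>i\<in>I. z i \<omega>)"

(* The sigma-algebra on the sample space generated by (y_1, ..., y_s), where y_i takes values
   in the measurable space Y i. It is trivial for s = 0. *)
definition obs_algebra ::
  "'w measure \<Rightarrow> (nat \<Rightarrow> 'b measure) \<Rightarrow> (nat \<Rightarrow> 'w \<Rightarrow> 'b) \<Rightarrow> nat \<Rightarrow> 'w measure" where
  "obs_algebra M Y y s = vimage_algebra (space M) (traj {1..s} y) (PiM {1..s} Y)"

(* real_cond_exp is a meaningful conditional expectation only for a subalgebra; this is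
   guaranteed by measurability of the observations. *)
lemma subalgebra_obs_algebra:
  assumes "\<And>i. i \<ge> 1 \<Longrightarrow> y i \<in> measurable M (Y i)"
  shows "subalgebra M (obs_algebra M Y y s)"
proof -
  have "traj {1..s} y \<in> measurable M (PiM {1..s} Y)"
    unfolding traj_def [abs_def] by (rule measurable_restrict) (use assms in auto)
  then have "sets (vimage_algebra (space M) (traj {1..s} y) (PiM {1..s} Y)) \<subseteq> sets M"
    by (auto simp: sets_vimage_algebra2 measurable_space measurable_sets Pi_iff)
  then show ?thesis
    by (simp add: subalgebra_def obs_algebra_def)
qed

(* E_{pi_t} is the conditional expectation given (y_1, ..., y_t), so II is a random variable:
   a function of the observed values, determined up to null sets. *)
definition II ::
  "'w measure \<Rightarrow> (nat \<Rightarrow> 'b measure) \<Rightarrow> (nat \<Rightarrow> 'w \<Rightarrow> 'a) \<Rightarrow> (nat \<Rightarrow> 'w \<Rightarrow> 'b) \<Rightarrow> nat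
    \<Rightarrow> ((nat \<Rightarrow> 'a) \<Rightarrow> real) \<Rightarrow> nat \<Rightarrow> 'w \<Rightarrow> real" where
  "II M Y x y t h \<Delta> =
     real_cond_exp M (obs_algebra M Y y t)
       (\<lambda>\<omega>. (real_cond_exp M (obs_algebra M Y y (t + \<Delta>)) (\<lambda>\<omega>'. h (traj {0..t} x \<omega>')) \<omega>
               - h (traj {0..t} x \<omega>))\<^sup>2)"

end

theory Submission
  imports Defs
begin

text \<open>Write \<open>e\<^sub>i\<close> for the conditional expectation of \<open>f = h(x\<^sub>0, \<dots>, x\<^sub>t)\<close> given the observations up
  to time \<open>t + \<Delta>\<^sub>i\<close>. Given the larger observation algebra, \<open>e\<^sub>2\<close> is the best predictor of \<open>f\<close> in
  conditional mean square, because \<open>f - e\<^sub>2\<close> is conditionally orthogonal to every predictor measurable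
  with respect to that algebra. The predictor \<open>e\<^sub>1\<close> is one of these, so its conditional
  error is at least as large; the tower property transfers the inequality to the algebra at
  time \<open>t\<close>.\<close>

text \<open>Since 2|fg| \<le> f^2 + g^2, the sum of the two squares is an integrable bound. This
  makes the cross terms in expanded squared errors integrable.\<close>

lemma integrable_mult_of_square_integrable:
  fixes f g :: "'a \<Rightarrow> real"
  assumes [measurable]: "f \<in> borel_measurable M" "g \<in> borel_measurable M"
    and "integrable M (\<lambda>x. (f x)\<^sup>2)" "integrable M (\<lambda>x. (g x)\<^sup>2)"
  shows "integrable M (\<lambda>x. f x * g x)"
proof (rule Bochner_Integration.integrable_bound)
  show "integrable M (\<lambda>x. (f x)\<^sup>2 + (g x)\<^sup>2)"
    using assms by simp
  show "AE x in M. norm (f x * g x) \<le> norm ((f x)\<^sup>2 + (g x)\<^sup>2)"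
  proof (rule AE_I2)
    fix x
    have "2 * (\<bar>f x\<bar> * \<bar>g x\<bar>) \<le> (f x)\<^sup>2 + (g x)\<^sup>2"
      using sum_squares_bound[of "\<bar>f x\<bar>" "\<bar>g x\<bar>"] by simp
    moreover have "0 \<le> \<bar>f x\<bar> * \<bar>g x\<bar>"
      by simp
    ultimately have "\<bar>f x\<bar> * \<bar>g x\<bar> \<le> (f x)\<^sup>2 + (g x)\<^sup>2"
      by linarith
    then show "norm (f x * g x) \<le> norm ((f x)\<^sup>2 + (g x)\<^sup>2)"
      by (simp add: abs_mult)
  qed
qed simp

lemma square_integrable_diff:
  fixes f g :: "'a \<Rightarrow> real"
  assumes [measurable]: "f \<in> borel_measurable M" "g \<in> borel_measurable M"
    and "integrable M (\<lambda>x. (f x)\<^sup>2)" "integrable M (\<lambda>x. (g x)\<^sup>2)"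
  shows "integrable M (\<lambda>x. (f x - g x)\<^sup>2)"
  using assms integrable_mult_of_square_integrable[OF assms]
  by (simp add: power2_diff mult.assoc)

context finite_measure_subalgebra
begin

text \<open>Conditional Jensen for the convex function u^2: the square of the conditional
  expectation is dominated by the conditional expectation of the square.\<close>

lemma square_integrable_real_cond_exp:
  assumes "integrable M f" "integrable M (\<lambda>x. (f x)\<^sup>2)"
  shows "integrable M (\<lambda>x. (real_cond_exp M F f x)\<^sup>2)"
  by (rule integrable_convex_cond_exp[where I = UNIV])
     (use assms in \<open>auto simp: convex_power2\<close>)

lemma real_cond_exp_least_squares:
  assumes f[measurable]: "f \<in> borel_measurable M" and f2: "integrable M (\<lambda>x. (f x)\<^sup>2)"
    and g[measurable]: "g \<in> borel_measurable F" and g2: "integrable M (\<lambda>x. (g x)\<^sup>2)"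
  shows "AE x in M. real_cond_exp M F (\<lambda>x. (real_cond_exp M F f x - f x)\<^sup>2) x
    \<le> real_cond_exp M F (\<lambda>x. (g x - f x)\<^sup>2) x"
proof -
  define e where "e = real_cond_exp M F f"
  have [measurable]: "e \<in> borel_measurable F" "e \<in> borel_measurable M"
    by (simp_all add: e_def)
  have [measurable]: "g \<in> borel_measurable M"
    by (rule measurable_from_subalg[OF subalg g])
  have fi: "integrable M f"
    using square_integrable_imp_integrable[OF f f2] .
  have ei: "integrable M e"
    using fi by (simp add: e_def real_cond_exp_int)
  have e2: "integrable M (\<lambda>x. (e x)\<^sup>2)"
    unfolding e_def by (rule square_integrable_real_cond_exp[OF fi f2])
  have ef: "integrable M (\<lambda>x. (e x - f x)\<^sup>2)" and ge: "integrable M (\<lambda>x. (g x - e x)\<^sup>2)"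
    and gf: "integrable M (\<lambda>x. (g x - f x)\<^sup>2)"
    using f2 g2 e2 by (auto intro!: square_integrable_diff)
  \<comment> \<open>The cross term of (g - f)^2 when g - f is split as (g - e) + (e - f).\<close>
  define c where "c x = (2 * (g x - e x)) * (e x - f x)" for x
  have ci: "integrable M c"
    unfolding c_def mult.assoc
    by (intro integrable_mult_right integrable_mult_of_square_integrable ge ef) simp_all
  have "AE x in M. real_cond_exp M F (\<lambda>x. e x - f x) x = 0"
    using real_cond_exp_diff[OF ei fi] real_cond_exp_F_meas[OF ei]
    by (auto simp: e_def)
  \<comment> \<open>The factor 2(g - e) is \<open>F\<close>-measurable, so it can be taken out; what
    remains is the conditional mean of e - f, which vanishes.\<close>
  moreover have "AE x in M. real_cond_exp M F c x
      = (2 * (g x - e x)) * real_cond_exp M F (\<lambda>x. e x - f x) x"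
    unfolding c_def by (rule real_cond_exp_mult) (use ci in \<open>simp_all add: c_def[abs_def]\<close>)
  ultimately have c0: "AE x in M. real_cond_exp M F c x = 0"
    by auto
  have "AE x in M. real_cond_exp M F (\<lambda>x. (e x - f x)\<^sup>2 + c x) x
      \<le> real_cond_exp M F (\<lambda>x. (g x - f x)\<^sup>2) x"
  proof (rule real_cond_exp_mono)
    \<comment> \<open>Dropping the square (g - e)^2 is the only loss.\<close>
    have "(g x - f x)\<^sup>2 = (e x - f x)\<^sup>2 + c x + (g x - e x)\<^sup>2" for x
      by (simp add: c_def power2_eq_square algebra_simps)
    then show "AE x in M. (e x - f x)\<^sup>2 + c x \<le> (g x - f x)\<^sup>2"
      by simp
  qed (use ef ci gf in auto)
  with real_cond_exp_add[OF ef ci] c0 show ?thesis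
    unfolding e_def[symmetric] by auto
qed

end

text \<open>Each y_i with i \<le> r is a coordinate of the longer trajectory, hence measurable for
  the algebra at time s; so the shorter trajectory is too, and its preimages generate nothing
  new.\<close>

lemma subalgebra_obs_algebra_mono:
  assumes "\<And>i. i \<ge> 1 \<Longrightarrow> y i \<in> measurable M (Y i)" and "r \<le> s"
  shows "subalgebra (obs_algebra M Y y s) (obs_algebra M Y y r)"
proof -
  let ?G = "obs_algebra M Y y s"
  \<comment> \<open>Because the trajectories land in the product space, the sets of the generated
    algebra are exactly the preimages of product-measurable sets.\<close>
  have traj_in: "traj {1..n} y \<in> space M \<rightarrow> space (PiM {1..n} Y)" for n
  proof
    fix \<omega> assume "\<omega> \<in> space M"
    then have "y i \<omega> \<in> space (Y i)" if "i \<in> {1..n}" for i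
      using that measurable_space[OF assms(1)] by simp
    then show "traj {1..n} y \<omega> \<in> space (PiM {1..n} Y)"
      by (simp add: traj_def space_PiM)
  qed
  have space: "space (obs_algebra M Y y n) = space M" for n
    by (simp add: obs_algebra_def)
  have "traj {1..s} y \<in> measurable ?G (PiM {1..s} Y)"
    unfolding obs_algebra_def by (rule measurable_vimage_algebra1[OF traj_in])
  then have "(\<lambda>\<omega>. traj {1..s} y \<omega> i) \<in> measurable ?G (Y i)" if "i \<in> {1..s}" for i
    using that by (rule measurable_compose[OF _ measurable_component_singleton])
  then have "y i \<in> measurable ?G (Y i)" if "i \<in> {1..r}" for i
    using that assms(2) by (auto simp: traj_def)
  then have "traj {1..r} y \<in> measurable ?G (PiM {1..r} Y)"
    unfolding traj_def [abs_def] by (rule measurable_restrict)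
  then have "sets (obs_algebra M Y y r) \<subseteq> sets ?G"
    unfolding obs_algebra_def[of _ _ _ r] sets_vimage_algebra2[OF traj_in]
    using measurable_sets[of "traj {1..r} y" ?G] by (auto simp: space)
  then show ?thesis
    by (simp add: subalgebra_def space)
qed

theorem proposition1:
  fixes M :: "'w measure"
    and X :: "nat \<Rightarrow> 'a measure" and Y :: "nat \<Rightarrow> 'b measure"
    and x :: "nat \<Rightarrow> 'w \<Rightarrow> 'a" and y :: "nat \<Rightarrow> 'w \<Rightarrow> 'b"
    and t :: nat and h :: "(nat \<Rightarrow> 'a) \<Rightarrow> real"
  assumes "prob_space M"
    and "\<And>i. x i \<in> measurable M (X i)"
    and "\<And>i. i \<ge> 1 \<Longrightarrow> y i \<in> measurable M (Y i)"
    and "h \<in> borel_measurable (PiM {0..t} X)"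
    and "integrable M (\<lambda>\<omega>. (h (traj {0..t} x \<omega>))\<^sup>2)"
  shows "AE \<omega> in M. \<forall>\<Delta>\<^sub>1 \<Delta>\<^sub>2. \<Delta>\<^sub>1 < \<Delta>\<^sub>2 \<longrightarrow>
           II M Y x y t h \<Delta>\<^sub>2 \<omega> \<le> II M Y x y t h \<Delta>\<^sub>1 \<omega>"
proof -
  interpret prob_space M by fact
  let ?F = "obs_algebra M Y y"
  define f where "f = (\<lambda>\<omega>. h (traj {0..t} x \<omega>))"
  define e where "e \<Delta> = real_cond_exp M (?F (t + \<Delta>)) f" for \<Delta>
  have II: "II M Y x y t h \<Delta> = real_cond_exp M (?F t) (\<lambda>\<omega>. (e \<Delta> \<omega> - f \<omega>)\<^sup>2)" for \<Delta>
    by (simp add: II_def e_def f_def)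
  have sub: "finite_measure_subalgebra M (?F s)" for s
    using subalgebra_obs_algebra[OF assms(3)] by unfold_locales
  have "traj {0..t} x \<in> measurable M (PiM {0..t} X)"
    unfolding traj_def [abs_def] by (rule measurable_restrict) (rule assms(2))
  then have f[measurable]: "f \<in> borel_measurable M"
    unfolding f_def by (rule measurable_compose) (rule assms(4))
  have f2: "integrable M (\<lambda>\<omega>. (f \<omega>)\<^sup>2)"
    using assms(5) by (simp add: f_def)
  have fi: "integrable M f"
    using square_integrable_imp_integrable[OF f f2] .
  have e2: "integrable M (\<lambda>\<omega>. (e \<Delta> \<omega>)\<^sup>2)" for \<Delta>
    unfolding e_def
    by (rule finite_measure_subalgebra.square_integrable_real_cond_exp[OF sub fi f2])
  have err: "integrable M (\<lambda>\<omega>. (e \<Delta> \<omega> - f \<omega>)\<^sup>2)" for \<Delta>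
    by (rule square_integrable_diff[OF _ f e2 f2]) (simp add: e_def)
  have "AE \<omega> in M. II M Y x y t h \<Delta>\<^sub>2 \<omega> \<le> II M Y x y t h \<Delta>\<^sub>1 \<omega>" if "\<Delta>\<^sub>1 < \<Delta>\<^sub>2" for \<Delta>\<^sub>1 \<Delta>\<^sub>2
  proof -
    \<comment> \<open>Least squares is applied at the later time: there e at \<Delta>1 is an
      admissible competitor and e at \<Delta>2 is the optimum.\<close>
    let ?G = "?F (t + \<Delta>\<^sub>2)"
    interpret F: finite_measure_subalgebra M "?F t" by (rule sub)
    interpret G: finite_measure_subalgebra M ?G by (rule sub)
    have "subalgebra ?G (?F (t + \<Delta>\<^sub>1))"
      by (rule subalgebra_obs_algebra_mono[OF assms(3)]) (use that in simp_all)
    then have "e \<Delta>\<^sub>1 \<in> borel_measurable ?G"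
      by (rule measurable_from_subalg) (simp add: e_def)
    note G.real_cond_exp_least_squares[OF f f2 this e2, folded e_def]
    then have "AE \<omega> in M. real_cond_exp M (?F t) (real_cond_exp M ?G (\<lambda>\<omega>. (e \<Delta>\<^sub>2 \<omega> - f \<omega>)\<^sup>2)) \<omega>
        \<le> real_cond_exp M (?F t) (real_cond_exp M ?G (\<lambda>\<omega>. (e \<Delta>\<^sub>1 \<omega> - f \<omega>)\<^sup>2)) \<omega>"
      by (rule F.real_cond_exp_mono) (simp_all add: G.real_cond_exp_int err)
    \<comment> \<open>Tower property: the algebra at time t is contained in \<open>?G\<close>, so
      conditioning on \<open>?G\<close> first changes nothing.\<close>
    moreover have "AE \<omega> in M. real_cond_exp M (?F t)
          (real_cond_exp M ?G (\<lambda>\<omega>. (e \<Delta> \<omega> - f \<omega>)\<^sup>2)) \<omega>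
        = II M Y x y t h \<Delta> \<omega>" for \<Delta>
      unfolding II
      by (rule F.real_cond_exp_nested_subalg[OF G.subalg _ err])
         (rule subalgebra_obs_algebra_mono[OF assms(3)], simp_all)
    note this[of \<Delta>\<^sub>1] this[of \<Delta>\<^sub>2]
    ultimately show ?thesis
      by auto
  qed
  then show ?thesis
    \<comment> \<open>The exceptional null set depends on the pair of lags; there are only countably
      many pairs, so one null set serves for all.\<close>
    by (simp add: AE_all_countable)
qed

end
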